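(* Let $\Gamma$ be a finitely generated group acting by isometries on a metric space $X$, and fix a point $x_0\in X$. For $R>0$ let $W_R(x_0)=\{\gamma\in\Gamma : d_X(\gamma x_0,x_0)\le R\}$. Suppose that $\operatorname{asdim} X\le k$ and that $\operatorname{asdim} W_R(x_0)\le n$ for all $R>0$. Then $\operatorname{asdim}\Gamma\le n+k$.
   Context: For a metric space $X$, $\operatorname{asdim} X\le n$ means: for every $D>0$ there exist families $\mathcal{U}_0,\ldots,\mathcal{U}_n$ of uniformly bounded subsets of $X$, each $D$-disjoint (distinct members are at distance $>D$), whose union covers $X$. $\operatorname{asdim}X$ is the smallest such $n$. A finitely generated group $\Gamma$ is regarded as a metric space with the left-invariant word metric of a finite generating set; $\operatorname{asdim}\Gamma$ does not depend on the choice. The subset $W_R(x_0)\subset\Gamma$ carries the metric restricted from $\Gamma$. *)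

theory Defs
  imports "HOL-Analysis.Analysis" "HOL-Algebra.Group_Action" "HOL-Algebra.Generated_Groups"
begin

section \<open>Asymptotic dimension\<close>

text \<open>The infimum is taken in the extended reals, so the distance to the empty set is \<open>\<infinity>\<close>.\<close>

definition set_distance :: "('a \<Rightarrow> 'a \<Rightarrow> real) \<Rightarrow> 'a set \<Rightarrow> 'a set \<Rightarrow> ereal" where
  "set_distance d U V = (INF (x, y) \<in> U \<times> V. ereal (d x y))"

definition disjoint_at_scale :: "('a \<Rightarrow> 'a \<Rightarrow> real) \<Rightarrow> real \<Rightarrow> 'a set set \<Rightarrow> bool" where
  "disjoint_at_scale d D \<U> \<longleftrightarrow>
     (\<forall>U\<in>\<U>. \<forall>V\<in>\<U>. U \<noteq> V \<longrightarrow> ereal D < set_distance d U V)"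

definition uniformly_bounded :: "('a \<Rightarrow> 'a \<Rightarrow> real) \<Rightarrow> 'a set set \<Rightarrow> bool" where
  "uniformly_bounded d \<U> \<longleftrightarrow> (\<exists>B. \<forall>U\<in>\<U>. \<forall>x\<in>U. \<forall>y\<in>U. d x y \<le> B)"

text \<open>
  The metric space is given by a carrier \<open>X\<close> and a distance function \<open>d\<close>, so that a subset
  with the restricted metric is obtained by shrinking the carrier and keeping \<open>d\<close>.
\<close>

definition asdim_at_most :: "'a set \<Rightarrow> ('a \<Rightarrow> 'a \<Rightarrow> real) \<Rightarrow> nat \<Rightarrow> bool" where
  "asdim_at_most X d n \<longleftrightarrow>
     (\<forall>D>0. \<exists>\<U> :: nat \<Rightarrow> 'a set set.
        (\<forall>i\<le>n. \<U> i \<subseteq> Pow X \<and> uniformly_bounded d (\<U> i) \<and> disjoint_at_scale d D (\<U> i)) \<and>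
        (\<Union>i\<le>n. \<Union>(\<U> i)) = X)"

text \<open>The value is \<open>\<infinity>\<close> if no \<open>n\<close> qualifies.\<close>

definition asdim :: "'a set \<Rightarrow> ('a \<Rightarrow> 'a \<Rightarrow> real) \<Rightarrow> enat" where
  "asdim X d = Inf {enat n | n. asdim_at_most X d n}"

lemma asdim_at_most_mono:
  assumes "asdim_at_most X d m" "m \<le> n"
  shows "asdim_at_most X d n"
  unfolding asdim_at_most_def
proof (intro allI impI)
  fix D :: real assume "D > 0"
  with assms(1) obtain \<U> where
    \<U>: "\<forall>i\<le>m. \<U> i \<subseteq> Pow X \<and> uniformly_bounded d (\<U> i) \<and> disjoint_at_scale d D (\<U> i)"
    and cover: "(\<Union>i\<le>m. \<Union>(\<U> i)) = X"
    unfolding asdim_at_most_def by meson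
  define \<V> where "\<V> i = (if i \<le> m then \<U> i else {})" for i
  have "\<V> i \<subseteq> Pow X \<and> uniformly_bounded d (\<V> i) \<and> disjoint_at_scale d D (\<V> i)" for i
  proof (cases "i \<le> m")
    case True
    then show ?thesis using \<U> by (simp add: \<V>_def)
  next
    case False
    then show ?thesis by (simp add: \<V>_def uniformly_bounded_def disjoint_at_scale_def)
  qed
  moreover have "(\<Union>i\<le>n. \<Union>(\<V> i)) = (\<Union>i\<le>m. \<Union>(\<U> i))"
  proof (rule subset_antisym)
    show "(\<Union>i\<le>n. \<Union>(\<V> i)) \<subseteq> (\<Union>i\<le>m. \<Union>(\<U> i))"
    proof
      fix x assume "x \<in> (\<Union>i\<le>n. \<Union>(\<V> i))"
      then obtain i U where "U \<in> \<V> i" "x \<in> U" by blast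
      then show "x \<in> (\<Union>i\<le>m. \<Union>(\<U> i))" by (cases "i \<le> m") (auto simp: \<V>_def)
    qed
    show "(\<Union>i\<le>m. \<Union>(\<U> i)) \<subseteq> (\<Union>i\<le>n. \<Union>(\<V> i))"
    proof
      fix x assume "x \<in> (\<Union>i\<le>m. \<Union>(\<U> i))"
      then obtain i U where "i \<le> m" "U \<in> \<U> i" "x \<in> U" by blast
      moreover from this have "i \<le> n" "U \<in> \<V> i" using assms(2) by (simp_all add: \<V>_def)
      ultimately show "x \<in> (\<Union>i\<le>n. \<Union>(\<V> i))" by blast
    qed
  qed
  ultimately show "\<exists>\<V>. (\<forall>i\<le>n. \<V> i \<subseteq> Pow X \<and> uniformly_bounded d (\<V> i) \<and> disjoint_at_scale d D (\<V> i)) \<and>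
        (\<Union>i\<le>n. \<Union>(\<V> i)) = X"
    using cover by (intro exI[of _ \<V>]) simp
qed

lemma asdim_le_iff: "asdim X d \<le> enat n \<longleftrightarrow> asdim_at_most X d n"
proof
  assume le: "asdim X d \<le> enat n"
  let ?A = "{enat n | n. asdim_at_most X d n}"
  have "asdim X d < enat (Suc n)" using le by (rule le_less_trans) simp
  then obtain a where "a \<in> ?A" "a < enat (Suc n)"
    unfolding asdim_def Inf_less_iff by (elim bexE)
  then obtain m where "asdim_at_most X d m" "m \<le> n" by auto
  then show "asdim_at_most X d n" by (rule asdim_at_most_mono)
next
  assume "asdim_at_most X d n"
  then show "asdim X d \<le> enat n" unfolding asdim_def by (intro Inf_lower) simp
qed


section \<open>Word metrics\<close>

definition word_length :: "('g, 'm) monoid_scheme \<Rightarrow> 'g set \<Rightarrow> 'g \<Rightarrow> nat" where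
  "word_length G S g =
     (LEAST n. \<exists>ws. length ws = n \<and> set ws \<subseteq> S \<union> m_inv G ` S \<and>
        foldr (mult G) ws \<one>\<^bsub>G\<^esub> = g)"

definition word_dist :: "('g, 'm) monoid_scheme \<Rightarrow> 'g set \<Rightarrow> 'g \<Rightarrow> 'g \<Rightarrow> real" where
  "word_dist G S g h = real (word_length G S (inv\<^bsub>G\<^esub> g \<otimes>\<^bsub>G\<^esub> h))"

context group
begin

lemma foldr_mult_closed:
  "set ws \<subseteq> carrier G \<Longrightarrow> foldr (\<otimes>) ws \<one> \<in> carrier G"
  by (induction ws) auto

lemma foldr_mult_append:
  "set us \<subseteq> carrier G \<Longrightarrow> set vs \<subseteq> carrier G \<Longrightarrow>
    foldr (\<otimes>) (us @ vs) \<one> = foldr (\<otimes>) us \<one> \<otimes> foldr (\<otimes>) vs \<one>"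
  by (induction us) (simp_all add: m_assoc foldr_mult_closed del: foldr_append)

lemma foldr_mult_inv:
  "set ws \<subseteq> carrier G \<Longrightarrow> inv (foldr (\<otimes>) ws \<one>) = foldr (\<otimes>) (rev (map (m_inv G) ws)) \<one>"
proof (induction ws)
  case (Cons a ws)
  have "set (rev (map (m_inv G) ws)) \<subseteq> carrier G" "set [inv a] \<subseteq> carrier G"
    using Cons.prems by auto
  from foldr_mult_append[OF this] Cons show ?case
    by (simp add: inv_mult_group foldr_mult_closed del: foldr_append)
qed simp

lemma word_length_le:
  assumes "set ws \<subseteq> S \<union> m_inv G ` S"
  shows "word_length G S (foldr (\<otimes>) ws \<one>) \<le> length ws"
  unfolding word_length_def by (rule Least_le) (use assms in blast)

context
  fixes S
  assumes gens: "S \<subseteq> carrier G" "generate G S = carrier G"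
begin

lemma word_closed: "set ws \<subseteq> S \<union> m_inv G ` S \<Longrightarrow> set ws \<subseteq> carrier G"
  using gens(1) by (erule_tac subset_trans) auto

lemma word_exists:
  assumes "g \<in> carrier G"
  shows "\<exists>ws. set ws \<subseteq> S \<union> m_inv G ` S \<and> foldr (\<otimes>) ws \<one> = g"
proof -
  have "g \<in> generate G S" using assms gens by simp
  then show ?thesis
  proof induction
    case one
    show ?case by (rule exI[of _ "[]"]) simp
  next
    case (incl h)
    then show ?case using gens(1) by (intro exI[of _ "[h]"]) auto
  next
    case (inv h)
    then show ?case using gens(1) by (intro exI[of _ "[inv h]"]) auto
  next
    case (eng h1 h2)
    then obtain us vs where w: "set us \<subseteq> S \<union> m_inv G ` S" "foldr (\<otimes>) us \<one> = h1"
      "set vs \<subseteq> S \<union> m_inv G ` S" "foldr (\<otimes>) vs \<one> = h2" by blast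
    then have "foldr (\<otimes>) (us @ vs) \<one> = h1 \<otimes> h2"
      using foldr_mult_append[of us vs] word_closed by (simp del: foldr_append)
    with w show ?case by (intro exI[of _ "us @ vs"]) auto
  qed
qed

lemma shortest_word:
  assumes "g \<in> carrier G"
  obtains ws where "length ws = word_length G S g" "set ws \<subseteq> S \<union> m_inv G ` S"
    "foldr (\<otimes>) ws \<one> = g"
proof -
  have "\<exists>n ws. length ws = n \<and> set ws \<subseteq> S \<union> m_inv G ` S \<and> foldr (\<otimes>) ws \<one> = g"
    using word_exists[OF assms] by blast
  from LeastI_ex[OF this] show ?thesis using that unfolding word_length_def by blast
qed

lemma word_length_eq_0_iff:
  assumes "g \<in> carrier G"
  shows "word_length G S g = 0 \<longleftrightarrow> g = \<one>"
proof
  assume "word_length G S g = 0"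
  then show "g = \<one>" using shortest_word[OF assms] by (metis foldr_Nil id_apply length_0_conv)
next
  assume "g = \<one>"
  then show "word_length G S g = 0" using word_length_le[of "[]" S] by simp
qed

lemma word_length_mult_le:
  assumes "g \<in> carrier G" "h \<in> carrier G"
  shows "word_length G S (g \<otimes> h) \<le> word_length G S g + word_length G S h"
proof -
  obtain us where us: "length us = word_length G S g" "set us \<subseteq> S \<union> m_inv G ` S" "foldr (\<otimes>) us \<one> = g"
    using shortest_word[OF assms(1)] .
  obtain vs where vs: "length vs = word_length G S h" "set vs \<subseteq> S \<union> m_inv G ` S" "foldr (\<otimes>) vs \<one> = h"
    using shortest_word[OF assms(2)] .
  have "foldr (\<otimes>) (us @ vs) \<one> = g \<otimes> h"
    using us vs foldr_mult_append[of us vs] word_closed by (simp del: foldr_append)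
  then show ?thesis using word_length_le[of "us @ vs" S] us vs by (simp del: foldr_append)
qed

lemma word_length_inv_le:
  assumes "g \<in> carrier G"
  shows "word_length G S (inv g) \<le> word_length G S g"
proof -
  obtain us where us: "length us = word_length G S g" "set us \<subseteq> S \<union> m_inv G ` S" "foldr (\<otimes>) us \<one> = g"
    using shortest_word[OF assms] .
  have "set (rev (map (m_inv G) us)) \<subseteq> S \<union> m_inv G ` S"
    using us(2) gens(1) by (force simp: subset_iff)
  moreover have "inv g = foldr (\<otimes>) (rev (map (m_inv G) us)) \<one>"
    using us word_closed foldr_mult_inv[of us] by simp
  ultimately show ?thesis using word_length_le[of "rev (map (m_inv G) us)" S] us(1) by simp
qed

lemma word_length_inv:
  "g \<in> carrier G \<Longrightarrow> word_length G S (inv g) = word_length G S g"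
  using word_length_inv_le[of g] word_length_inv_le[of "inv g"] by simp

lemma word_dist_eq_0_iff:
  "g \<in> carrier G \<Longrightarrow> h \<in> carrier G \<Longrightarrow> word_dist G S g h = 0 \<longleftrightarrow> g = h"
  using inv_solve_left'[of \<one> g h] by (auto simp: word_dist_def word_length_eq_0_iff)

lemma word_dist_commute:
  assumes "g \<in> carrier G" "h \<in> carrier G"
  shows "word_dist G S g h = word_dist G S h g"
  using word_length_inv[of "inv g \<otimes> h"] assms by (simp add: word_dist_def inv_mult_group)

lemma word_dist_triangle:
  assumes "f \<in> carrier G" "g \<in> carrier G" "h \<in> carrier G"
  shows "word_dist G S f h \<le> word_dist G S f g + word_dist G S g h"
proof -
  have "g \<otimes> (inv g \<otimes> h) = h" using assms by (simp flip: m_assoc)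
  then have "(inv f \<otimes> g) \<otimes> (inv g \<otimes> h) = inv f \<otimes> h" using assms by (simp add: m_assoc)
  then show ?thesis
    using word_length_mult_le[of "inv f \<otimes> g" "inv g \<otimes> h"] assms by (simp add: word_dist_def)
qed

end

lemma word_dist_left_invariant:
  assumes "a \<in> carrier G" "g \<in> carrier G" "h \<in> carrier G"
  shows "word_dist G S (a \<otimes> g) (a \<otimes> h) = word_dist G S g h"
proof -
  have "inv a \<otimes> (a \<otimes> h) = h" using assms by (simp flip: m_assoc)
  then show ?thesis using assms by (simp add: word_dist_def inv_mult_group m_assoc)
qed

end


section \<open>Isometric actions\<close>

definition isometric_action ::
  "('g, 'm) monoid_scheme \<Rightarrow> 'x set \<Rightarrow> ('x \<Rightarrow> 'x \<Rightarrow> real) \<Rightarrow> ('g \<Rightarrow> 'x \<Rightarrow> 'x) \<Rightarrow> bool" where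
  "isometric_action G X d \<phi> \<longleftrightarrow>
     group_action G X \<phi> \<and>
     (\<forall>g\<in>carrier G. \<forall>x\<in>X. \<forall>y\<in>X. d (\<phi> g x) (\<phi> g y) = d x y)"

definition almost_stabilizer ::
  "('g, 'm) monoid_scheme \<Rightarrow> ('x \<Rightarrow> 'x \<Rightarrow> real) \<Rightarrow> ('g \<Rightarrow> 'x \<Rightarrow> 'x) \<Rightarrow> real \<Rightarrow> 'x \<Rightarrow> 'g set" where
  "almost_stabilizer G d \<phi> R x\<^sub>0 = {g \<in> carrier G. d (\<phi> g x\<^sub>0) x\<^sub>0 \<le> R}"

end

theory Submission
  imports Defs
begin

text \<open>
  The orbit map \<open>\<Gamma> \<rightarrow> X\<close>, \<open>\<gamma> \<mapsto> \<gamma>x\<^sub>0\<close>, is Lipschitz, and the preimages of balls around orbit points are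
  left translates of the sets \<open>W\<^sub>R(x\<^sub>0)\<close>, so the claim is a Hurewicz theorem for Lipschitz maps whose
  fibres have uniform asymptotic dimension at most \<open>n\<close>. Take families \<open>\<U>\<^sub>0, \<dots>, \<U>\<^sub>k\<close> covering the base at
  a large scale. By Kolmogorov's trick the preimage of a neighbourhood of each \<open>A \<in> \<U>\<^sub>j\<close> is covered by
  \<open>n + k + 1\<close> coloured sets such that every point has at least \<open>k + 1\<close> colours; the scale of these
  covers at level \<open>j + 1\<close> is chosen beyond the bounds at level \<open>j\<close>. Colour \<open>c\<close> is switched off where the
  distance to \<open>\<Union>\<U>\<^sub>j\<close> lies in a thin shell depending on \<open>c\<close>. The shells of the different colours are
  disjoint, so a point covered through \<open>A \<in> \<U>\<^sub>i\<close> loses at most one colour for each \<open>j \<noteq> i\<close> and keeps one.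
\<close>

section \<open>Components at a given scale\<close>

locale pseudometric_on =
  fixes M :: "'a set" and d :: "'a \<Rightarrow> 'a \<Rightarrow> real"
  assumes refl [simp]: "x \<in> M \<Longrightarrow> d x x = 0"
    and commute: "x \<in> M \<Longrightarrow> y \<in> M \<Longrightarrow> d x y = d y x"
    and triangle: "x \<in> M \<Longrightarrow> y \<in> M \<Longrightarrow> z \<in> M \<Longrightarrow> d x z \<le> d x y + d y z"

text \<open>Each step stays in \<open>Z\<close>, but a point outside \<open>Z\<close> is still
  chained to itself; hence the separate assumption \<open>x \<in> Z\<close> in what follows.\<close>

definition chained :: "('a \<Rightarrow> 'a \<Rightarrow> real) \<Rightarrow> real \<Rightarrow> 'a set \<Rightarrow> 'a \<Rightarrow> 'a \<Rightarrow> bool" where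
  "chained d r Z = (\<lambda>x y. x \<in> Z \<and> y \<in> Z \<and> d x y \<le> r)\<^sup>*\<^sup>*"

text \<open>This records one colour as a single set: its \<open>r\<close>-components play the role
  of a disjoint, uniformly bounded family.\<close>

definition bounded_components :: "('a \<Rightarrow> 'a \<Rightarrow> real) \<Rightarrow> real \<Rightarrow> real \<Rightarrow> 'a set \<Rightarrow> bool" where
  "bounded_components d r B Z \<longleftrightarrow> (\<forall>x\<in>Z. \<forall>y. chained d r Z x y \<longrightarrow> d x y \<le> B)"

lemma chained_refl [simp]: "chained d r Z x x"
  by (simp add: chained_def)

lemma chained_step:
  "chained d r Z x y \<Longrightarrow> y \<in> Z \<Longrightarrow> z \<in> Z \<Longrightarrow> d y z \<le> r \<Longrightarrow> chained d r Z x z"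
  unfolding chained_def by (rule rtranclp.rtrancl_into_rtrancl) auto

lemma chained_trans: "chained d r Z x y \<Longrightarrow> chained d r Z y z \<Longrightarrow> chained d r Z x z"
  unfolding chained_def by (rule rtranclp_trans)

lemma chained_in: "chained d r Z x y \<Longrightarrow> x \<in> Z \<Longrightarrow> y \<in> Z"
  unfolding chained_def by (induction rule: rtranclp_induct) auto

lemma chained_induct [consumes 2, case_names base step]:
  assumes "chained d r Z x y" "x \<in> Z" "P x"
    and "\<And>y z. chained d r Z x y \<Longrightarrow> y \<in> Z \<Longrightarrow> z \<in> Z \<Longrightarrow> d y z \<le> r \<Longrightarrow> P y \<Longrightarrow> P z"
  shows "P y"
  using assms(1) unfolding chained_def
proof (induction rule: rtranclp_induct)
  case base
  show ?case by (rule assms(3))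
next
  case (step y z)
  then show ?case using assms(4)[of y z] by (auto simp: chained_def)
qed

lemma chained_mono:
  assumes "chained d r Z x y" "Z \<subseteq> Z'" "r \<le> r'"
  shows "chained d r' Z' x y"
  using assms(1) unfolding chained_def
  by (rule rtranclp_mono[THEN predicate2D, rotated]) (use assms(2,3) in auto)

lemma bounded_componentsD:
  "bounded_components d r B Z \<Longrightarrow> chained d r Z x y \<Longrightarrow> x \<in> Z \<Longrightarrow> d x y \<le> B"
  unfolding bounded_components_def by blast

lemma bounded_components_mono:
  assumes "bounded_components d r B Z" "Z' \<subseteq> Z" "r' \<le> r" "B \<le> B'"
  shows "bounded_components d r' B' Z'"
  using assms chained_mono[OF _ assms(2,3)] unfolding bounded_components_def by force

lemma bounded_components_isometry:
  assumes "bounded_components d r B Z"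
    and "\<And>x. x \<in> Z' \<Longrightarrow> h x \<in> Z"
    and "\<And>x y. x \<in> Z' \<Longrightarrow> y \<in> Z' \<Longrightarrow> d (h x) (h y) = d' x y"
  shows "bounded_components d' r B Z'"
  unfolding bounded_components_def
proof (intro ballI allI impI)
  fix x y assume x: "x \<in> Z'" and y: "chained d' r Z' x y"
  have "chained d r Z (h x) (h y)" using y x
  proof (induction rule: chained_induct)
    case (step y z)
    then show ?case using chained_step[of d r Z "h x" "h y" "h z"] assms(2,3) by auto
  qed simp
  then have "d (h x) (h y) \<le> B"
    using assms(1,2) x unfolding bounded_components_def by auto
  then show "d' x y \<le> B" using assms(3)[OF x chained_in[OF y x]] by simp
qed

lemma disjoint_at_scale_less:
  assumes "disjoint_at_scale d D \<U>" "U \<in> \<U>" "V \<in> \<U>" "U \<noteq> V" "x \<in> U" "y \<in> V"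
  shows "D < d x y"
proof -
  have "ereal D < set_distance d U V"
    using assms unfolding disjoint_at_scale_def by auto
  also have "set_distance d U V \<le> ereal (d x y)"
    unfolding set_distance_def using assms(5,6) by (intro INF_lower2[of "(x, y)"]) auto
  finally show ?thesis by simp
qed

text \<open>Points of distinct members are more than \<open>r\<close> apart, so an
  \<open>r\<close>-chain never leaves the member in which it starts.\<close>

lemma bounded_components_Union:
  assumes "disjoint_at_scale d r \<U>" "\<And>U x y. U \<in> \<U> \<Longrightarrow> x \<in> U \<Longrightarrow> y \<in> U \<Longrightarrow> d x y \<le> B"
  shows "bounded_components d r B (\<Union>\<U>)"
  unfolding bounded_components_def
proof (intro ballI allI impI)
  fix x y assume x: "x \<in> \<Union>\<U>" and y: "chained d r (\<Union>\<U>) x y"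
  obtain U where U: "U \<in> \<U>" "x \<in> U" using x by blast
  have "y \<in> U" using y x
  proof (induction rule: chained_induct)
    case (step y z)
    then obtain V where V: "V \<in> \<U>" "z \<in> V" by blast
    then show ?case using disjoint_at_scale_less[OF assms(1) U(1) V(1), of y z] step by force
  qed (fact U(2))
  then show "d x y \<le> B" using assms(2) U by blast
qed

context pseudometric_on
begin

lemma chained_sym:
  assumes "chained d r Z x y" "x \<in> Z" "Z \<subseteq> M"
  shows "chained d r Z y x"
  using assms(1,2)
proof (induction rule: chained_induct)
  case (step y z)
  then have "chained d r Z z y"
    using chained_step[OF chained_refl, of z Z y d r] commute[of y z] subsetD[OF assms(3)] by simp
  then show ?case using step(5) by (rule chained_trans)
qed simp

text \<open>The members are the \<open>(D + 1)\<close>-components. Distances between distinct ones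
  exceed \<open>D + 1\<close>; the margin 1 keeps the infimum strictly above
  \<open>D\<close>.\<close>

lemma components_family:
  assumes "bounded_components d (D + 1) B Z" "Z \<subseteq> M"
  obtains \<U> where "\<U> \<subseteq> Pow Z" "uniformly_bounded d \<U>" "disjoint_at_scale d D \<U>" "\<Union>\<U> = Z"
proof -
  define comp where "comp x = {y. chained d (D + 1) Z x y}" for x
  have sub: "comp x \<subseteq> Z" if "x \<in> Z" for x
    using chained_in that unfolding comp_def by fastforce
  have "uniformly_bounded d (comp ` Z)"
    unfolding uniformly_bounded_def
  proof (intro exI ballI)
    fix U y z assume "U \<in> comp ` Z" "y \<in> U" "z \<in> U"
    then obtain x where x: "x \<in> Z" "y \<in> comp x" "z \<in> comp x" by blast
    then have "d x y \<le> B" "d x z \<le> B"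
      using assms(1) unfolding bounded_components_def comp_def by auto
    moreover have "y \<in> M" "x \<in> M" "z \<in> M" using x sub[OF x(1)] assms(2) by auto
    ultimately show "d y z \<le> 2 * B" using triangle[of y x z] commute[of x y] by simp
  qed
  moreover have "disjoint_at_scale d D (comp ` Z)"
    unfolding disjoint_at_scale_def
  proof (intro ballI impI)
    fix U V assume UV: "U \<in> comp ` Z" "V \<in> comp ` Z" "U \<noteq> V"
    then obtain x y where xy: "x \<in> Z" "U = comp x" "y \<in> Z" "V = comp y" by blast
    have far: "D + 1 < d u v" if "u \<in> U" "v \<in> V" for u v
    proof (rule ccontr)
      assume "\<not> D + 1 < d u v"
      then have "chained d (D + 1) Z u v"
        using chained_step[OF chained_refl, of u Z v d "D + 1"] that xy sub by auto
      then have "chained d (D + 1) Z x y"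
        using that xy chained_sym[OF _ xy(3) assms(2), of "D + 1" v] unfolding comp_def
        by (blast intro: chained_trans)
      moreover from this have "chained d (D + 1) Z y x"
        using chained_sym xy(1) assms(2) by blast
      ultimately have "comp x = comp y"
        unfolding comp_def by (blast intro: chained_trans)
      then show False using UV xy by simp
    qed
    have "ereal D < ereal (D + 1)" by simp
    also have "\<dots> \<le> set_distance d U V"
      unfolding set_distance_def using far by (force intro!: INF_greatest)
    finally show "ereal D < set_distance d U V" .
  qed
  moreover have "\<Union>(comp ` Z) = Z" using sub by (auto simp: comp_def)
  ultimately show ?thesis using that[of "comp ` Z"] sub by blast
qed

text \<open>An \<open>r\<close>-chain makes excursions into \<open>P\<close> between visits to
  \<open>Q\<close>. An excursion has extent at most \<open>C\<close>, so successive visits to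
  \<open>Q\<close> are at most \<open>C + 2 * r\<close> apart and form an \<open>s\<close>-chain, of
  extent at most \<open>B\<close>. The stretches before and after it add at most
  \<open>C + r\<close> each.\<close>

lemma bounded_components_Un:
  assumes P: "bounded_components d r C P" and Q: "bounded_components d s B Q"
    and s: "s \<ge> C + 2 * r" and "C \<ge> 0" "r \<ge> 0" "B \<ge> 0" and sub: "P \<subseteq> M" "Q \<subseteq> M"
  shows "bounded_components d r (B + 2 * C + 2 * r) (P \<union> Q)"
  unfolding bounded_components_def
proof (intro ballI allI impI)
  fix x y assume x: "x \<in> P \<union> Q" and y: "chained d r (P \<union> Q) x y"
  \<comment> \<open>\<open>q\<close> stands for the latest visit to \<open>Q\<close>, and
    \<open>y\<close> is \<open>q\<close> itself or lies on the excursion into \<open>P\<close> that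
    follows.\<close>
  define tail where "tail q y \<longleftrightarrow> y = q \<or> (\<exists>p\<in>P. d q p \<le> r \<and> chained d r P p y)" for q y
  have tail: "d q y \<le> r + C" if t: "tail q y" "q \<in> Q" for q y
  proof (cases "y = q")
    case True
    then show ?thesis using t(2) sub \<open>C \<ge> 0\<close> \<open>r \<ge> 0\<close> by (auto simp: subset_iff)
  next
    case False
    then obtain p where p: "p \<in> P" "d q p \<le> r" "chained d r P p y"
      using t(1) unfolding tail_def by blast
    have "d p y \<le> C" "y \<in> P"
      using bounded_componentsD[OF P p(3,1)] chained_in[OF p(3,1)] by auto
    then show ?thesis using triangle[of q p y] p sub t(2) by force
  qed
  \<comment> \<open>Invariant along the chain: either \<open>y\<close> is joined to \<open>x\<close>
    inside \<open>P\<close>, or the visits to \<open>Q\<close> lead by an \<open>s\<close>-chain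
    from some \<open>q'\<close> close to \<open>x\<close> to the latest one,
    \<open>q\<close>.\<close>
  define good where "good y \<longleftrightarrow> x \<in> P \<and> chained d r P x y \<or>
    (\<exists>q'\<in>Q. \<exists>q\<in>Q. d x q' \<le> C + r \<and> chained d s Q q' q \<and> tail q y)" for y
  have tail_self: "tail q q" for q unfolding tail_def by simp
  have tail_P: "tail q y" if "p \<in> P" "d q p \<le> r" "chained d r P p y" for p q y
    using that unfolding tail_def by blast
  have good_P: "good y" if "x \<in> P" "chained d r P x y" for y
    using that unfolding good_def by blast
  have good_Q: "good y"
    if "q' \<in> Q" "q \<in> Q" "d x q' \<le> C + r" "chained d s Q q' q" "tail q y" for q' q y
    using that unfolding good_def by blast
  have "good y" using y x
  proof (induction rule: chained_induct)
    case base
    show ?case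
    proof (cases "x \<in> P")
      case False
      then have "x \<in> Q" using x by blast
      moreover from this have "d x x \<le> C + r"
        using sub(2) \<open>C \<ge> 0\<close> \<open>r \<ge> 0\<close> by (simp add: subset_iff)
      ultimately show ?thesis using good_Q[of x x x] chained_refl tail_self by simp
    qed (rule good_P; simp)
  next
    case (step y z)
    have M: "x \<in> M" "y \<in> M" "z \<in> M" using x step sub by auto
    show ?case
    proof (cases "x \<in> P \<and> chained d r P x y")
      case True
      then have xP: "x \<in> P" "chained d r P x y" by auto
      have y: "y \<in> P" "d x y \<le> C"
        using chained_in[OF xP(2,1)] bounded_componentsD[OF P xP(2,1)] .
      show ?thesis
      proof (cases "z \<in> P")
        case True
        show ?thesis by (rule good_P[OF xP(1) chained_step[OF xP(2) y(1) True step(4)]])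
      next
        case False
        then have "z \<in> Q" using step by auto
        moreover have "d x z \<le> C + r" using triangle[of x y z] M y step(4) by auto
        ultimately show ?thesis using good_Q[of z z z] chained_refl tail_self by simp
      qed
    next
      case False
      then obtain q' q where q: "q' \<in> Q" "q \<in> Q" "d x q' \<le> C + r" "chained d s Q q' q" "tail q y"
        using step(5) unfolding good_def by blast
      show ?thesis
      proof (cases "z \<in> Q")
        case True
        have "d q z \<le> s"
          using tail[OF q(5,2)] triangle[of q y z] M q(2) sub step(4) s by force
        then have "chained d s Q q' z" using chained_step[OF q(4,2) True] by simp
        then show ?thesis using good_Q[OF q(1) True q(3) _ tail_self] by blast
      next
        case False
        then have "z \<in> P" using step by auto
        have "tail q z"
        proof (cases "y = q")
          case True
          then show ?thesis using tail_P[OF \<open>z \<in> P\<close> _ chained_refl] step(4) by simp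
        next
          case False
          then obtain p where p: "p \<in> P" "d q p \<le> r" "chained d r P p y"
            using q(5) unfolding tail_def by blast
          then have "chained d r P p z"
            using chained_step[OF p(3) chained_in[OF p(3,1)] \<open>z \<in> P\<close> step(4)] by simp
          then show ?thesis using tail_P[OF p(1,2)] by blast
        qed
        then show ?thesis by (rule good_Q[OF q(1-4)])
      qed
    qed
  qed
  then show "d x y \<le> B + 2 * C + 2 * r"
    unfolding good_def
  proof (elim disjE conjE bexE)
    assume "x \<in> P" "chained d r P x y"
    then have "d x y \<le> C" using bounded_componentsD[OF P] by blast
    then show ?thesis using \<open>C \<ge> 0\<close> \<open>r \<ge> 0\<close> \<open>B \<ge> 0\<close> by simp
  next
    fix q' q assume q: "q' \<in> Q" "q \<in> Q" "d x q' \<le> C + r" "chained d s Q q' q" "tail q y"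
    have "x \<in> M" "q \<in> M" "q' \<in> M" "y \<in> M" using q x chained_in[OF y x] sub by auto
    moreover have "d q' q \<le> B" using bounded_componentsD[OF Q q(4,1)] .
    ultimately show ?thesis
      using tail[OF q(5,2)] q(3) triangle[of x q' q] triangle[of x q y] by simp
  qed
qed

text \<open>The sets are added one at a time: if \<open>C\<close> bounds the union so far, the next
  scale is \<open>C + 2 * r\<close>, as \<open>bounded_components_Un\<close> demands, and the bound
  of the next set is \<open>\<beta>\<close> at that scale. Scales and final bound are fixed before
  \<open>T\<close>, so they serve all such unions at once.\<close>

lemma bounded_components_UN:
  assumes \<beta>: "\<forall>s>0. \<beta> s \<ge> (0::real)" and "r > 0"
  shows "\<exists>s C. (\<forall>j. s j > 0) \<and> C \<ge> 0 \<and>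
    (\<forall>T. (\<forall>j\<le>k. T j \<subseteq> M \<and> bounded_components d (s j) (\<beta> (s j)) (T j)) \<longrightarrow>
      bounded_components d r C (\<Union>j\<le>(k::nat). T j))"
proof (induction k)
  case 0
  show ?case using assms by (intro exI[of _ "\<lambda>_. r"] exI[of _ "\<beta> r"]) auto
next
  case (Suc k)
  then obtain s C where sC: "\<And>j. s j > 0" "C \<ge> 0"
    "\<And>T. (\<And>j. j \<le> k \<Longrightarrow> T j \<subseteq> M \<and> bounded_components d (s j) (\<beta> (s j)) (T j)) \<Longrightarrow>
      bounded_components d r C (\<Union>j\<le>k. T j)" by blast
  define t where "t = C + 2 * r"
  have t: "t > 0" using sC \<open>r > 0\<close> by (simp add: t_def)
  show ?case
  proof (intro exI[of _ "s(Suc k := t)"] exI[of _ "\<beta> t + 2 * C + 2 * r"] conjI allI impI)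
    show "(s(Suc k := t)) j > 0" for j using sC t by simp
    show "\<beta> t + 2 * C + 2 * r \<ge> 0" using \<beta>[rule_format, OF t] sC \<open>r > 0\<close> by simp
    fix T assume "\<forall>j\<le>Suc k. T j \<subseteq> M \<and>
      bounded_components d ((s(Suc k := t)) j) (\<beta> ((s(Suc k := t)) j)) (T j)"
    then have T: "T j \<subseteq> M" "bounded_components d ((s(Suc k := t)) j) (\<beta> ((s(Suc k := t)) j)) (T j)"
      if "j \<le> Suc k" for j using that by auto
    have *: "bounded_components d (s j) (\<beta> (s j)) (T j)" if "j \<le> k" for j
      using T(2)[of j] that by (simp split: if_splits)
    have "bounded_components d r C (\<Union>j\<le>k. T j)" by (rule sC(3)) (use T(1) * in auto)
    moreover have "bounded_components d t (\<beta> t) (T (Suc k))" using T(2)[of "Suc k"] by simp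
    moreover have "(\<Union>j\<le>k. T j) \<subseteq> M" "T (Suc k) \<subseteq> M"
      by (rule UN_least, rule T(1); simp) (rule T(1); simp)
    ultimately have "bounded_components d r (\<beta> t + 2 * C + 2 * r) ((\<Union>j\<le>k. T j) \<union> T (Suc k))"
      using bounded_components_Un[of r C "\<Union>j\<le>k. T j" t "\<beta> t" "T (Suc k)"] \<beta>[rule_format, OF t] sC(2) \<open>r > 0\<close>
      by (simp add: t_def)
    moreover have "(\<Union>j\<le>Suc k. T j) = (\<Union>j\<le>k. T j) \<union> T (Suc k)"
      by (auto simp: le_Suc_eq)
    ultimately show "bounded_components d r (\<beta> t + 2 * C + 2 * r) (\<Union>j\<le>Suc k. T j)" by simp
  qed
qed

end


section \<open>Covers with many colours\<close>

text \<open>The counting condition asks for at least \<open>N - n\<close> colours at each point, in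
  additive form to avoid truncated subtraction. For \<open>N = Suc n\<close> it is ordinary
  covering.\<close>

definition multicover ::
  "('a \<Rightarrow> 'a \<Rightarrow> real) \<Rightarrow> real \<Rightarrow> real \<Rightarrow> nat \<Rightarrow> nat \<Rightarrow> 'a set \<Rightarrow> (nat \<Rightarrow> 'a set) \<Rightarrow> bool" where
  "multicover d r B n N A Z \<longleftrightarrow>
     (\<forall>i<N. Z i \<subseteq> A \<and> bounded_components d r B (Z i)) \<and>
     (\<forall>x\<in>A. N \<le> n + card {i. i < N \<and> x \<in> Z i})"

lemma multicover_mono:
  assumes "multicover d r B n N A Z" "B \<le> B'" "A' \<subseteq> A"
  shows "multicover d r B' n N A' (\<lambda>i. Z i \<inter> A')"
proof -
  have "{i. i < N \<and> x \<in> Z i \<inter> A'} = {i. i < N \<and> x \<in> Z i}" if "x \<in> A'" for x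
    using that by auto
  then show ?thesis
    using assms bounded_components_mono[of d r B _ _ r B'] unfolding multicover_def by auto
qed

lemma asdim_at_mostE:
  assumes "asdim_at_most A d n" "D > 0"
  obtains \<U> B where "B \<ge> 0" "\<And>i. i \<le> n \<Longrightarrow> disjoint_at_scale d D (\<U> i)"
    "\<And>i U x y. i \<le> n \<Longrightarrow> U \<in> \<U> i \<Longrightarrow> x \<in> U \<Longrightarrow> y \<in> U \<Longrightarrow> d x y \<le> B"
    "(\<Union>i\<le>n. \<Union>(\<U> i)) = A"
proof -
  obtain \<U> where \<U>: "\<forall>i\<le>n. \<U> i \<subseteq> Pow A \<and> uniformly_bounded d (\<U> i) \<and> disjoint_at_scale d D (\<U> i)"
    "(\<Union>i\<le>n. \<Union>(\<U> i)) = A"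
    using assms(1)[unfolded asdim_at_most_def, THEN spec, THEN mp, OF assms(2)]
    by (elim exE conjE) (rule that)
  have "\<forall>i\<in>{..n}. \<exists>b. \<forall>U\<in>\<U> i. \<forall>x\<in>U. \<forall>y\<in>U. d x y \<le> b"
    using \<U>(1) unfolding uniformly_bounded_def by simp
  then obtain b where b: "\<forall>i\<in>{..n}. \<forall>U\<in>\<U> i. \<forall>x\<in>U. \<forall>y\<in>U. d x y \<le> b i"
    unfolding bchoice_iff by blast
  \<comment> \<open>One bound for all \<open>n + 1\<close> families; the \<open>0\<close> makes it
    nonnegative.\<close>
  define B where "B = Max (insert 0 (b ` {..n}))"
  have "b i \<le> B" if "i \<le> n" for i using that unfolding B_def by (intro Max_ge) auto
  then have "d x y \<le> B" if "i \<le> n" "U \<in> \<U> i" "x \<in> U" "y \<in> U" for i U x y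
    using b that by force
  moreover have "B \<ge> 0" unfolding B_def by (rule Max_ge) auto
  ultimately show ?thesis using that[of B \<U>] \<U> by simp
qed

lemma asdim_at_most_multicover:
  assumes "asdim_at_most A d n" "r > 0"
  shows "\<exists>B Z. multicover d r B n (Suc n) A Z"
proof -
  obtain \<U> B where \<U>: "\<And>i. i \<le> n \<Longrightarrow> disjoint_at_scale d r (\<U> i)"
    "\<And>i U x y. i \<le> n \<Longrightarrow> U \<in> \<U> i \<Longrightarrow> x \<in> U \<Longrightarrow> y \<in> U \<Longrightarrow> d x y \<le> B"
    and cover: "(\<Union>i\<le>n. \<Union>(\<U> i)) = A"
    using asdim_at_mostE[OF assms] by metis
  have "bounded_components d r B (\<Union>(\<U> i))" if "i \<le> n" for i
    using \<U> that by (intro bounded_components_Union)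
  moreover have "Suc n \<le> n + card {i. i < Suc n \<and> x \<in> \<Union>(\<U> i)}" if x: "x \<in> A" for x
  proof -
    have "{i. i < Suc n \<and> x \<in> \<Union>(\<U> i)} \<noteq> {}" using x cover by (force simp: less_Suc_eq_le)
    then have "card {i. i < Suc n \<and> x \<in> \<Union>(\<U> i)} > 0" by (simp add: card_gt_0_iff)
    then show ?thesis by simp
  qed
  moreover have "\<Union>(\<U> i) \<subseteq> A" if "i \<le> n" for i using cover that by auto
  ultimately have "multicover d r B n (Suc n) A (\<lambda>i. \<Union>(\<U> i))"
    unfolding multicover_def by (simp add: less_Suc_eq_le)
  then show ?thesis by blast
qed

context pseudometric_on
begin

text \<open>Replace each point of \<open>Z'\<close> by a point of \<open>Z\<close> within
  \<open>r\<close>: a step of length \<open>r\<close> becomes one of length at most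
  \<open>r + r + r\<close>, and the two ends cost \<open>2 * r\<close>.\<close>

lemma bounded_components_thickening:
  assumes Z: "bounded_components d (3 * r) B Z" "Z \<subseteq> M"
    and Z': "Z' \<subseteq> M" "\<And>x. x \<in> Z' \<Longrightarrow> \<exists>z\<in>Z. d x z \<le> r"
  shows "bounded_components d r (B + 2 * r) Z'"
  unfolding bounded_components_def
proof (intro ballI allI impI)
  fix x y assume x: "x \<in> Z'" and y: "chained d r Z' x y"
  obtain h where h: "\<And>x. x \<in> Z' \<Longrightarrow> h x \<in> Z" "\<And>x. x \<in> Z' \<Longrightarrow> d x (h x) \<le> r"
    using Z'(2) by metis
  have "chained d (3 * r) Z (h x) (h y)" using y x
  proof (induction rule: chained_induct)
    case (step y z)
    have "y \<in> M" "z \<in> M" "h y \<in> M" "h z \<in> M" using step h Z Z' by auto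
    then have "d (h y) (h z) \<le> 3 * r"
      using triangle[of "h y" y "h z"] triangle[of y z "h z"] commute[of "h y" y] h(2)[of y] h(2)[of z] step
      by simp
    then show ?case using chained_step step h by metis
  qed simp
  then have "d (h x) (h y) \<le> B" using bounded_componentsD[OF Z(1) _ h(1)[OF x]] by simp
  moreover have "y \<in> Z'" using chained_in y x by metis
  moreover from this have "y \<in> M" "x \<in> M" "h y \<in> M" "h x \<in> M" using x h Z Z' by auto
  ultimately show "d x y \<le> B + 2 * r"
    using triangle[of x "h x" y] triangle[of "h x" "h y" y] commute[of "h y" y] h(2)[of x] h(2)[of y] x
    by simp
qed

text \<open>
  Kolmogorov's trick: thicken every colour by \<open>r\<close>. A chain of points that still have the minimal
  number of colours keeps the same set of colours, so such points may form an additional colour.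
\<close>

lemma multicover_Suc:
  assumes Z: "multicover d (3 * r) B n N A Z" and "n < N" "r > 0" "A \<subseteq> M"
  shows "\<exists>Z'. multicover d r (B + 2 * r) n (Suc N) A Z'"
proof -
  have Zi: "Z i \<subseteq> A" "bounded_components d (3 * r) B (Z i)" if "i < N" for i
    using Z that unfolding multicover_def by auto
  have many: "N \<le> n + card {i. i < N \<and> x \<in> Z i}" if "x \<in> A" for x
    using Z that unfolding multicover_def by auto
  define T where "T i = {x \<in> A. \<exists>z\<in>Z i. d x z \<le> r}" for i
  have ZT: "Z i \<subseteq> T i" if "i < N" for i
    using Zi(1)[OF that] \<open>A \<subseteq> M\<close> \<open>r > 0\<close> unfolding T_def
    by (auto intro!: bexI simp: subset_iff)
  \<comment> \<open>\<open>L\<close> collects the points that have only \<open>N - n\<close>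
    colours, the least possible number, even after thickening; it becomes colour
    \<open>N\<close>.\<close>
  define L where "L = {x \<in> A. n + card {i. i < N \<and> x \<in> T i} = N}"
  define Z' where "Z' = T(N := L)"
  \<comment> \<open>Already the sets \<open>Z i\<close> give \<open>N - n\<close> colours at
    \<open>x\<close>, so thickening has added none.\<close>
  have same: "i < N \<and> x \<in> T i \<longleftrightarrow> i < N \<and> x \<in> Z i" if "x \<in> L" for x i
  proof -
    have "{i. i < N \<and> x \<in> Z i} = {i. i < N \<and> x \<in> T i}"
    proof (rule card_seteq)
      show "{i. i < N \<and> x \<in> Z i} \<subseteq> {i. i < N \<and> x \<in> T i}" using ZT by auto
      show "card {i. i < N \<and> x \<in> T i} \<le> card {i. i < N \<and> x \<in> Z i}"
        using that many[of x] unfolding L_def by auto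
    qed simp
    then show ?thesis by blast
  qed
  have "bounded_components d r (B + 2 * r) (T i)" if "i < N" for i
  proof (rule bounded_components_thickening[OF Zi(2)[OF that]])
    show "Z i \<subseteq> M" "T i \<subseteq> M" using Zi(1)[OF that] \<open>A \<subseteq> M\<close> unfolding T_def by auto
    show "\<exists>z\<in>Z i. d x z \<le> r" if "x \<in> T i" for x using that unfolding T_def by simp
  qed
  moreover have "bounded_components d r (B + 2 * r) L"
    unfolding bounded_components_def
  proof (intro ballI allI impI)
    fix x y assume x: "x \<in> L" and y: "chained d r L x y"
    \<comment> \<open>As \<open>n < N\<close>, the point \<open>x\<close> has a colour
      \<open>i\<close>, and the chain stays in \<open>Z i\<close>: a point of \<open>L\<close>
      within \<open>r\<close> of \<open>Z i\<close> lies in \<open>T i\<close>, and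
      \<open>same\<close> puts it into \<open>Z i\<close>.\<close>
    have "{i. i < N \<and> x \<in> T i} \<noteq> {}"
      using x \<open>n < N\<close> unfolding L_def by force
    then obtain i where i: "i < N" "x \<in> Z i" using same[OF x] by blast
    have "y \<in> Z i \<and> chained d (3 * r) (Z i) x y" using y x
    proof (induction rule: chained_induct)
      case (step y z)
      have "y \<in> A" "z \<in> A" using step(2,3) unfolding L_def by auto
      then have "d z y \<le> r" using commute[of y z] step(4) subsetD[OF \<open>A \<subseteq> M\<close>] by simp
      then have "z \<in> T i" using step(5) \<open>z \<in> A\<close> unfolding T_def by auto
      then have z: "z \<in> Z i" using same[OF step(3), of i] i by simp
      have "d y z \<le> 3 * r" using step(4) \<open>r > 0\<close> by simp
      then show ?case using chained_step[of d "3 * r" "Z i" x y z] step(5) z by simp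
    qed (use i in simp)
    then have "d x y \<le> B" using bounded_componentsD[OF Zi(2)[OF i(1)] _ i(2)] by simp
    then show "d x y \<le> B + 2 * r" using \<open>r > 0\<close> by simp
  qed
  moreover have "Suc N \<le> n + card {i. i < Suc N \<and> x \<in> Z' i}" if x: "x \<in> A" for x
  proof -
    have "{i. i < N \<and> x \<in> Z i} \<subseteq> {i. i < N \<and> x \<in> T i}" using ZT by auto
    then have "card {i. i < N \<and> x \<in> Z i} \<le> card {i. i < N \<and> x \<in> T i}" by (intro card_mono) auto
    then have ge: "N \<le> n + card {i. i < N \<and> x \<in> T i}" using many[OF x] by simp
    have eq: "{i. i < Suc N \<and> x \<in> Z' i} = {i. i < N \<and> x \<in> T i} \<union> (if x \<in> L then {N} else {})"
      unfolding Z'_def by (auto simp: less_Suc_eq)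
    show ?thesis
    proof (cases "x \<in> L")
      case True
      then have "card {i. i < Suc N \<and> x \<in> Z' i} = Suc (card {i. i < N \<and> x \<in> T i})"
        unfolding eq by simp
      then show ?thesis using ge by simp
    next
      case False
      then have "N \<noteq> n + card {i. i < N \<and> x \<in> T i}" using x unfolding L_def by simp
      moreover have "card {i. i < Suc N \<and> x \<in> Z' i} = card {i. i < N \<and> x \<in> T i}"
        using False unfolding eq by simp
      ultimately show ?thesis using ge by linarith
    qed
  qed
  moreover have "T i \<subseteq> A" "L \<subseteq> A" for i unfolding T_def L_def by auto
  ultimately have "multicover d r (B + 2 * r) n (Suc N) A Z'"
    unfolding multicover_def Z'_def by (simp add: less_Suc_eq)
  then show ?thesis by blast
qed

text \<open>Each extra colour costs a factor 3 in the scale, so the hypothesis is made at every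
  scale. The new bound \<open>B + 2 * r\<close> does not depend on \<open>A\<close>, so uniformity
  over \<open>\<A>\<close> survives.\<close>

lemma multicover_add:
  assumes "\<And>A. A \<in> \<A> \<Longrightarrow> A \<subseteq> M"
    and "\<And>r. r > 0 \<Longrightarrow> \<exists>B. \<forall>A\<in>\<A>. \<exists>Z. multicover d r B n (Suc n) A Z"
    and "r > 0"
  shows "\<exists>B. \<forall>A\<in>\<A>. \<exists>Z. multicover d r B n (Suc (n + k)) A Z"
  using \<open>r > 0\<close>
proof (induction k arbitrary: r)
  case 0
  then show ?case using assms(2) by simp
next
  case (Suc k)
  obtain B where B: "\<forall>A\<in>\<A>. \<exists>Z. multicover d (3 * r) B n (Suc (n + k)) A Z"
  proof -
    have "3 * r > 0" using Suc.prems by simp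
    from Suc.IH[OF this] show ?thesis using that by blast
  qed
  have "\<exists>Z. multicover d r (B + 2 * r) n (Suc (n + Suc k)) A Z" if A: "A \<in> \<A>" for A
  proof -
    obtain Z where "multicover d (3 * r) B n (Suc (n + k)) A Z" using B A by blast
    then have "\<exists>Z. multicover d r (B + 2 * r) n (Suc (Suc (n + k))) A Z"
      by (rule multicover_Suc) (use assms(1)[OF A] Suc.prems in simp_all)
    then show ?thesis by simp
  qed
  then show ?case by blast
qed

end


section \<open>A Hurewicz theorem\<close>

text \<open>The quantifiers in \<open>fibres\<close> express uniformity: \<open>B\<close> depends on
  \<open>R\<close> and \<open>r\<close> but not on the centre \<open>x\<close>.\<close>

theorem asdim_at_most_fibration:
  assumes "pseudometric_on M d" "pseudometric_on Y e"
    and f: "\<And>p. p \<in> M \<Longrightarrow> f p \<in> Y"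
    and lip: "\<And>p q. p \<in> M \<Longrightarrow> q \<in> M \<Longrightarrow> e (f p) (f q) \<le> L * d p q" and "L > 0"
    and base: "asdim_at_most Y e k"
    and fibres: "\<And>R r. R > 0 \<Longrightarrow> r > 0 \<Longrightarrow>
      \<exists>B. \<forall>x\<in>M. \<exists>Z. multicover d r B n (Suc n) {p \<in> M. e (f p) (f x) \<le> R} Z"
  shows "asdim_at_most M d (n + k)"
  unfolding asdim_at_most_def
proof (intro allI impI)
  fix D :: real assume "D > 0"
  interpret M: pseudometric_on M d by fact
  interpret Y: pseudometric_on Y e by fact

  \<comment> \<open>Choice of scales\<close>
  define r where "r = D + 1"
  define N where "N = Suc (n + k)"
  define \<rho> where "\<rho> = L * r"
  have r: "r > 0" and \<rho>: "\<rho> > 0" using \<open>D > 0\<close> \<open>L > 0\<close> by (simp_all add: r_def \<rho>_def)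
  \<comment> \<open>\<open>\<rho>\<close> bounds the displacement under \<open>f\<close> of a step
    of length \<open>r\<close>. Disjointness at scale \<open>2 * N * \<rho>\<close> prevents an
    image point from being within \<open>c * \<rho>\<close> of one member of \<open>\<U> j\<close>
    and within \<open>(c + 1) * \<rho>\<close> of another when \<open>c < N\<close>.\<close>
  have "2 * real N * \<rho> > 0" using \<rho> by (simp add: N_def)
  obtain \<U> b where "b \<ge> 0" and \<U>:
      "\<And>j. j \<le> k \<Longrightarrow> disjoint_at_scale e (2 * real N * \<rho>) (\<U> j)"
      "\<And>j A x y. j \<le> k \<Longrightarrow> A \<in> \<U> j \<Longrightarrow> x \<in> A \<Longrightarrow> y \<in> A \<Longrightarrow> e x y \<le> b"
      "(\<Union>j\<le>k. \<Union>(\<U> j)) = Y"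
    by (rule asdim_at_mostE[OF base \<open>2 * real N * \<rho> > 0\<close>]) (rule that)
  \<comment> \<open>Two image points within \<open>N * \<rho>\<close> of the same member, which has
    diameter at most \<open>b\<close>, are at most \<open>R\<close> apart.\<close>
  define R where "R = b + 2 * real N * \<rho>"
  have "R > 0" unfolding R_def using \<open>b \<ge> 0\<close> \<open>2 * real N * \<rho> > 0\<close> by (rule add_nonneg_pos)
  define fibre where "fibre x = {p \<in> M. e (f p) (f x) \<le> R}" for x
  have "\<exists>B. B \<ge> 0 \<and> (\<forall>x\<in>M. \<exists>Z. multicover d s B n N (fibre x) Z)" if "s > 0" for s
  proof -
    have "\<exists>B. \<forall>A\<in>fibre ` M. \<exists>Z. multicover d s B n N A Z"
      unfolding N_def
    proof (rule M.multicover_add)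
      show "\<exists>B. \<forall>A\<in>fibre ` M. \<exists>Z. multicover d r B n (Suc n) A Z" if "r > 0" for r
        using fibres[OF \<open>R > 0\<close> that] by (auto simp: fibre_def)
    qed (use that in \<open>auto simp: fibre_def\<close>)
    then obtain B where B: "\<And>x. x \<in> M \<Longrightarrow> \<exists>Z. multicover d s B n N (fibre x) Z" by blast
    have "\<exists>Z. multicover d s (max B 0) n N (fibre x) Z" if "x \<in> M" for x
      using B[OF that] multicover_mono[of d s B n N _ _ "max B 0"] by fastforce
    then show ?thesis by (intro exI[of _ "max B 0"]) auto
  qed
  then obtain \<beta> where \<beta>: "\<forall>s>0. \<beta> s \<ge> 0"
    "\<And>s x. s > 0 \<Longrightarrow> x \<in> M \<Longrightarrow> \<exists>Z. multicover d s (\<beta> s) n N (fibre x) Z" by metis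
  \<comment> \<open>The scales \<open>s j\<close> and the bound \<open>C\<close> are fixed before
    any cover is chosen; pieces of level \<open>j\<close> will be covered at scale
    \<open>s j\<close>.\<close>
  obtain s C where sC: "\<forall>j. s j > 0"
    "\<forall>T. (\<forall>j\<le>k. T j \<subseteq> M \<and> bounded_components d (s j) (\<beta> (s j)) (T j)) \<longrightarrow>
      bounded_components d r C (\<Union>j\<le>k. T j)"
    by (rule M.bounded_components_UN[OF \<beta>(1) r, of k, THEN exE], elim exE conjE) (rule that)

  \<comment> \<open>Neighbourhoods of the pieces and their coloured covers\<close>
  define near where "near a A p \<longleftrightarrow> (\<exists>y\<in>A. e (f p) y \<le> real a * \<rho>)" for a A p
  have near_mono: "near a' A p" if "near a A p" "a \<le> a'" for a a' A p
  proof -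
    have "real a * \<rho> \<le> real a' * \<rho>" using that(2) \<rho> by (intro mult_right_mono) auto
    then show ?thesis using that(1) unfolding near_def by force
  qed
  have near_unique: "A = A'"
    if h: "j \<le> k" "A \<in> \<U> j" "A' \<in> \<U> j" "near c A p" "near (Suc c) A' p" "c < N" "p \<in> M" for j A A' c p
  proof (rule ccontr)
    assume "A \<noteq> A'"
    obtain y y' where y: "y \<in> A" "e (f p) y \<le> real c * \<rho>" "y' \<in> A'" "e (f p) y' \<le> real (Suc c) * \<rho>"
      using h(4,5) unfolding near_def by blast
    have "y \<in> Y" "y' \<in> Y" using y \<U>(3) h by auto
    then have "e y y' \<le> real c * \<rho> + real (Suc c) * \<rho>"
      using Y.triangle[of y "f p" y'] Y.commute[of "f p" y] f[OF h(7)] y by simp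
    also have "\<dots> \<le> 2 * real N * \<rho>"
    proof -
      have "real c + real (Suc c) \<le> 2 * real N" using h(6) by simp
      from mult_right_mono[OF this, of \<rho>] \<rho> show ?thesis by (simp add: algebra_simps)
    qed
    finally show False
      using disjoint_at_scale_less[OF \<U>(1)[OF h(1)] h(2,3) \<open>A \<noteq> A'\<close> y(1,3)] by simp
  qed
  \<comment> \<open>A member of \<open>\<U> j\<close> may be far from the image of \<open>M\<close>,
    and then the choice is arbitrary; \<open>in_fibre\<close> speaks only of members with some
    \<open>p\<close> near them. Centring at a point of \<open>M\<close> makes the covers of fibres
    available.\<close>
  define ctr where "ctr A = (SOME x. x \<in> M \<and> near N A x)" for A
  have in_fibre: "ctr A \<in> M \<and> p \<in> fibre (ctr A)"
    if h: "j \<le> k" "A \<in> \<U> j" "near N A p" "p \<in> M" for j A p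
  proof -
    have ctr: "ctr A \<in> M" "near N A (ctr A)"
      using someI[of "\<lambda>x. x \<in> M \<and> near N A x" p] h unfolding ctr_def by auto
    obtain y y' where y: "y \<in> A" "e (f p) y \<le> real N * \<rho>" "y' \<in> A" "e (f (ctr A)) y' \<le> real N * \<rho>"
      using h(3) ctr(2) unfolding near_def by blast
    have "y \<in> Y" "y' \<in> Y" using y \<U>(3) h by auto
    then have "e (f p) (f (ctr A)) \<le> e (f p) y + e y (f (ctr A))"
      "e y (f (ctr A)) \<le> e y y' + e y' (f (ctr A))" "e y' (f (ctr A)) = e (f (ctr A)) y'"
      using Y.triangle Y.commute f[OF h(4)] f[OF ctr(1)] by blast+
    moreover have "e y y' \<le> b" using \<U>(2)[OF h(1,2) y(1,3)] .
    ultimately have "e (f p) (f (ctr A)) \<le> R" using y(2,4) unfolding R_def by linarith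
    then show ?thesis using ctr h by (simp add: fibre_def)
  qed
  define V where "V j A = (SOME Z. multicover d (s j) (\<beta> (s j)) n N (fibre (ctr A)) Z)" for j A
  have V: "multicover d (s j) (\<beta> (s j)) n N (fibre (ctr A)) (V j A)" if "ctr A \<in> M" for j A
    unfolding V_def using someI_ex[OF \<beta>(2)[OF sC(1)[rule_format] that]] .

  text \<open>
    Colour \<open>c\<close> is not used at points whose distance to \<open>\<Union>(\<U> j)\<close> lies in \<open>(c\<rho>, (c+1)\<rho>]\<close>.
    Hence the pieces near which an \<open>r\<close>-chain of colour \<open>c\<close> passes do not change along the chain,
    while every \<open>j\<close> forbids at most one colour at each point.
  \<close>
  define zone where "zone j c = {p \<in> M. (\<exists>A\<in>\<U> j. near (Suc c) A p) \<and> \<not> (\<exists>A\<in>\<U> j. near c A p)}" for j c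
  define W where "W c = {p \<in> M. (\<forall>j\<le>k. p \<notin> zone j c) \<and> (\<exists>j\<le>k. \<exists>A\<in>\<U> j. near c A p \<and> p \<in> V j A c)}" for c
  \<comment> \<open>The step moves the image by at most \<open>\<rho>\<close>, so \<open>q\<close>
    is within \<open>(c + 1) * \<rho>\<close> of \<open>A\<close>. Being off the shell, it is within
    \<open>c * \<rho>\<close> of some member, which \<open>near_unique\<close> identifies with
    \<open>A\<close>.\<close>
  have near_step: "near c A q"
    if h: "j \<le> k" "A \<in> \<U> j" "near c A p" "p \<in> M" "q \<in> W c" "d p q \<le> r" "c < N" for j A c p q
  proof -
    have q: "q \<in> M" "q \<notin> zone j c" using h unfolding W_def by auto
    obtain y where y: "y \<in> A" "e (f p) y \<le> real c * \<rho>" using h(3) unfolding near_def by blast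
    have "y \<in> Y" using y \<U>(3) h by auto
    have "e (f p) (f q) \<le> L * d p q" using lip h q by auto
    also have "\<dots> \<le> \<rho>" using \<open>L > 0\<close> h(6) unfolding \<rho>_def by (intro mult_left_mono) auto
    finally have "e (f q) y \<le> \<rho> + e (f p) y"
      using Y.triangle[of "f q" "f p" y] Y.commute[of "f p" "f q"] f[OF q(1)] f[OF h(4)] \<open>y \<in> Y\<close>
      by simp
    also have "\<dots> \<le> real (Suc c) * \<rho>" using y(2) by (simp add: distrib_right)
    finally have "e (f q) y \<le> real (Suc c) * \<rho>" .
    then have A: "near (Suc c) A q" using y unfolding near_def by blast
    then obtain A' where A': "A' \<in> \<U> j" "near c A' q"
      using q h(2) unfolding zone_def by blast
    then show ?thesis using near_unique[OF h(1) A'(1) h(2) A'(2) A h(7) q(1)] by simp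
  qed

  \<comment> \<open>Boundedness of each colour\<close>
  have W: "bounded_components d r C (W c)" if c: "c < N" for c
    unfolding bounded_components_def
  proof (intro ballI allI impI)
    fix x y assume x: "x \<in> W c" and y: "chained d r (W c) x y"
    \<comment> \<open>Only pieces near the start \<open>x\<close> of the chain are kept. For each
      \<open>j\<close> there is at most one, so \<open>T j\<close> lies in a single
      \<open>V j A c\<close> and inherits its bound.\<close>
    define T where "T j = {p \<in> M. \<exists>A\<in>\<U> j. near c A x \<and> near c A p \<and> p \<in> V j A c}" for j
    have WM: "W c \<subseteq> M" unfolding W_def by auto
    have T: "bounded_components d (s j) (\<beta> (s j)) (T j)" if j: "j \<le> k" for j
    proof (cases "\<exists>A\<in>\<U> j. near c A x \<and> T j \<noteq> {}")
      case True
      then obtain A where A: "A \<in> \<U> j" "near c A x" by blast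
      have "ctr A \<in> M" using in_fibre[OF j A(1), of x] near_mono[OF A(2), of N] c x WM by auto
      then have "bounded_components d (s j) (\<beta> (s j)) (V j A c)"
        using V[of A j] c unfolding multicover_def by auto
      moreover have "T j \<subseteq> V j A c"
        unfolding T_def using near_unique[OF j A(1) _ A(2) near_mono[of c _ x "Suc c"] c] x WM by auto
      ultimately show ?thesis by (auto intro: bounded_components_mono)
    next
      case False
      then have "T j = {}" unfolding T_def by auto
      then show ?thesis by (simp add: bounded_components_def)
    qed
    have sub: "p \<in> (\<Union>j\<le>k. T j)" if "p \<in> W c" "\<And>j A. j \<le> k \<Longrightarrow> A \<in> \<U> j \<Longrightarrow> near c A p \<Longrightarrow> near c A x" for p
      using that unfolding W_def T_def by blast
    \<comment> \<open>Applied backwards along the chain, \<open>near_step\<close> shows that a piece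
      near a later point is near \<open>x\<close>; hence the chain stays in the union of the
      \<open>T j\<close>.\<close>
    have "(\<forall>j\<le>k. \<forall>A\<in>\<U> j. near c A y \<longrightarrow> near c A x) \<and> chained d r (\<Union>j\<le>k. T j) x y"
      using y x
    proof (induction rule: chained_induct)
      case (step y z)
      have yz: "y \<in> M" "z \<in> M" using step WM by auto
      have z: "near c A x" if "j \<le> k" "A \<in> \<U> j" "near c A z" for j A
        using near_step[OF that yz(2) step(2) _ c] M.commute[OF yz] step that by auto
      have "y \<in> (\<Union>j\<le>k. T j)" "z \<in> (\<Union>j\<le>k. T j)"
        by (rule sub; use step z in blast)+
      then have "chained d r (\<Union>j\<le>k. T j) x z" using chained_step step by metis
      then show ?case using z by blast
    qed simp
    moreover have "bounded_components d r C (\<Union>j\<le>k. T j)"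
      by (rule sC(2)[rule_format]) (use T in \<open>auto simp: T_def\<close>)
    moreover have "x \<in> (\<Union>j\<le>k. T j)" by (rule sub) (use x in auto)
    ultimately show "d x y \<le> C" unfolding bounded_components_def by blast
  qed

  \<comment> \<open>Covering by the colours\<close>
  have cover: "\<exists>c<N. p \<in> W c" if p: "p \<in> M" for p
  proof -
    obtain i A where i: "i \<le> k" "A \<in> \<U> i" "f p \<in> A" using \<U>(3) f[OF p] by blast
    \<comment> \<open>Since \<open>f p\<close> lies in \<open>A\<close>, this includes the radius 0
      for \<open>c = 0\<close>; so level \<open>i\<close> itself forbids no colour at
      \<open>p\<close>.\<close>
    have near: "near c A p" for c
      using i(3) f[OF p] \<rho> unfolding near_def by (intro bexI[of _ "f p"]) auto
    have "ctr A \<in> M" "p \<in> fibre (ctr A)" using in_fibre[OF i(1,2) near p] by auto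
    then have "N \<le> n + card {c. c < N \<and> p \<in> V i A c}"
      using V[of A i] unfolding multicover_def by auto
    \<comment> \<open>At least \<open>N - n = k + 1\<close> colours are present, against at most one
      forbidden by each of the \<open>k\<close> other levels.\<close>
    then have many: "k < card {c. c < N \<and> p \<in> V i A c}" by (simp add: N_def)
    have "card {c. c < N \<and> p \<in> zone j c} \<le> 1" for j
    proof -
      \<comment> \<open>If \<open>c < c'\<close>, being within \<open>(c + 1) * \<rho>\<close>
        implies being within \<open>c' * \<rho>\<close>, which the shell of \<open>c'\<close>
        excludes.\<close>
      have "c = c'" if "p \<in> zone j c" "p \<in> zone j c'" for c c'
      proof (rule ccontr)
        assume "c \<noteq> c'"
        then consider "Suc c \<le> c'" | "Suc c' \<le> c" by linarith
        then show False
          by cases (use that near_mono in \<open>unfold zone_def, blast+\<close>)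
      qed
      then have "\<forall>c\<in>{c. c < N \<and> p \<in> zone j c}. \<forall>c'\<in>{c. c < N \<and> p \<in> zone j c}. c = c'" by blast
      then show ?thesis using card_le_Suc0_iff_eq[of "{c. c < N \<and> p \<in> zone j c}"] by simp
    qed
    then have "(\<Sum>j\<in>{..k} - {i}. card {c. c < N \<and> p \<in> zone j c}) \<le> card ({..k} - {i}) * 1"
      using sum_bounded_above[of "{..k} - {i}" "\<lambda>j. card {c. c < N \<and> p \<in> zone j c}" 1] by simp
    moreover have "card ({..k} - {i}) = k" using i(1) by simp
    ultimately have bad: "card (\<Union>j\<in>{..k} - {i}. {c. c < N \<and> p \<in> zone j c}) \<le> k"
      using card_UN_le[of "{..k} - {i}" "\<lambda>j. {c. c < N \<and> p \<in> zone j c}"] by simp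
    have "\<not> {c. c < N \<and> p \<in> V i A c} \<subseteq> (\<Union>j\<in>{..k} - {i}. {c. c < N \<and> p \<in> zone j c})"
    proof
      assume "{c. c < N \<and> p \<in> V i A c} \<subseteq> (\<Union>j\<in>{..k} - {i}. {c. c < N \<and> p \<in> zone j c})"
      then have "card {c. c < N \<and> p \<in> V i A c} \<le> card (\<Union>j\<in>{..k} - {i}. {c. c < N \<and> p \<in> zone j c})"
        by (rule card_mono[rotated]) simp
      then show False using many bad by linarith
    qed
    then obtain c where c: "c < N" "p \<in> V i A c" "\<And>j. j \<le> k \<Longrightarrow> j \<noteq> i \<Longrightarrow> p \<notin> zone j c" by blast
    moreover have "p \<notin> zone i c" using near i(2) unfolding zone_def by blast
    ultimately have "p \<in> W c" using p i near unfolding W_def by blast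
    then show ?thesis using c by blast
  qed

  \<comment> \<open>Passage back to disjoint families\<close>
  have WM: "W c \<subseteq> M" for c by (auto simp: W_def)
  have "\<exists>\<V>. \<V> \<subseteq> Pow (W c) \<and> uniformly_bounded d \<V> \<and> disjoint_at_scale d D \<V> \<and> \<Union>\<V> = W c"
    if "c < N" for c
    by (rule M.components_family[OF W[OF that, unfolded r_def] WM]) blast
  then obtain \<V> where \<V>: "\<And>c. c < N \<Longrightarrow> \<V> c \<subseteq> Pow (W c) \<and> uniformly_bounded d (\<V> c) \<and>
    disjoint_at_scale d D (\<V> c) \<and> \<Union>(\<V> c) = W c" by metis
  show "\<exists>\<V>. (\<forall>i\<le>n + k. \<V> i \<subseteq> Pow M \<and> uniformly_bounded d (\<V> i) \<and> disjoint_at_scale d D (\<V> i)) \<and>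
    (\<Union>i\<le>n + k. \<Union>(\<V> i)) = M"
  proof (intro exI[of _ \<V>] conjI allI impI)
    fix i assume "i \<le> n + k"
    then have "i < N" by (simp add: N_def)
    from \<V>[OF this] WM[of i]
    show "\<V> i \<subseteq> Pow M" "uniformly_bounded d (\<V> i)" "disjoint_at_scale d D (\<V> i)" by auto
  next
    have "(\<Union>i\<le>n + k. \<Union>(\<V> i)) = (\<Union>i\<le>n + k. W i)" using \<V> by (intro SUP_cong) (auto simp: N_def)
    then show "(\<Union>i\<le>n + k. \<Union>(\<V> i)) = M" using cover WM by (force simp: N_def less_Suc_eq_le)
  qed
qed


section \<open>Isometric actions\<close>

text \<open>Each generator or inverse moves \<open>x\<^sub>0\<close> by at most \<open>L\<close>,
  and under isometries these displacements add up along a word. Applying this to a shortest word for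
  the quotient of \<open>g\<close> and \<open>h\<close> gives the estimate.\<close>

lemma isometric_action_Lipschitz:
  assumes "group G" "finite S" "S \<subseteq> carrier G" "generate G S = carrier G"
    and "Metric_space X d" "isometric_action G X d \<phi>" "x\<^sub>0 \<in> X"
  shows "\<exists>L>0. \<forall>g\<in>carrier G. \<forall>h\<in>carrier G. d (\<phi> g x\<^sub>0) (\<phi> h x\<^sub>0) \<le> L * word_dist G S g h"
proof -
  interpret group G by fact
  interpret Metric_space X d by fact
  interpret group_action G X \<phi> using assms unfolding isometric_action_def by simp
  have iso: "d (\<phi> g x) (\<phi> g y) = d x y" if "g \<in> carrier G" "x \<in> X" "y \<in> X" for g x y
    using assms that unfolding isometric_action_def by simp
  have inX: "\<phi> g x \<in> X" if "g \<in> carrier G" "x \<in> X" for g x using element_image that by blast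
  \<comment> \<open>The summand 1 keeps \<open>L\<close> positive even if every generator fixes
    \<open>x\<^sub>0\<close>.\<close>
  define L where "L = 1 + (\<Sum>s\<in>S \<union> m_inv G ` S. d x\<^sub>0 (\<phi> s x\<^sub>0))"
  have L: "d x\<^sub>0 (\<phi> s x\<^sub>0) \<le> L" if "s \<in> S \<union> m_inv G ` S" for s
    using member_le_sum[of s "S \<union> m_inv G ` S" "\<lambda>s. d x\<^sub>0 (\<phi> s x\<^sub>0)"] that \<open>finite S\<close>
    by (simp add: L_def)
  have words: "d x\<^sub>0 (\<phi> (foldr (\<otimes>\<^bsub>G\<^esub>) ws \<one>\<^bsub>G\<^esub>) x\<^sub>0) \<le> L * length ws"
    if "set ws \<subseteq> S \<union> m_inv G ` S" for ws
    using that
  proof (induction ws)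
    case Nil
    then show ?case using \<open>x\<^sub>0 \<in> X\<close> by (simp flip: id_eq_one)
  next
    case (Cons s ws)
    let ?h = "foldr (\<otimes>\<^bsub>G\<^esub>) ws \<one>\<^bsub>G\<^esub>"
    have "set (s # ws) \<subseteq> carrier G" using word_closed[OF assms(3,4)] Cons.prems by blast
    then have s: "s \<in> carrier G" and h: "?h \<in> carrier G" using foldr_mult_closed[of ws] by simp_all
    have "d x\<^sub>0 (\<phi> (s \<otimes>\<^bsub>G\<^esub> ?h) x\<^sub>0) \<le> d x\<^sub>0 (\<phi> s x\<^sub>0) + d (\<phi> s x\<^sub>0) (\<phi> s (\<phi> ?h x\<^sub>0))"
      using composition_rule s h inX triangle \<open>x\<^sub>0 \<in> X\<close> by simp
    also have "d (\<phi> s x\<^sub>0) (\<phi> s (\<phi> ?h x\<^sub>0)) = d x\<^sub>0 (\<phi> ?h x\<^sub>0)"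
      using iso s h inX \<open>x\<^sub>0 \<in> X\<close> by simp
    also have "d x\<^sub>0 (\<phi> s x\<^sub>0) + d x\<^sub>0 (\<phi> ?h x\<^sub>0) \<le> L + L * length ws"
      using L[of s] Cons by (intro add_mono) auto
    finally show ?case by (simp add: algebra_simps)
  qed
  have "d (\<phi> g x\<^sub>0) (\<phi> h x\<^sub>0) \<le> L * word_dist G S g h" if g: "g \<in> carrier G" and h: "h \<in> carrier G" for g h
  proof -
    let ?k = "inv\<^bsub>G\<^esub> g \<otimes>\<^bsub>G\<^esub> h"
    have k: "?k \<in> carrier G" using g h by simp
    obtain ws where ws: "length ws = word_length G S ?k" "set ws \<subseteq> S \<union> m_inv G ` S"
      "foldr (\<otimes>\<^bsub>G\<^esub>) ws \<one>\<^bsub>G\<^esub> = ?k"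
      using shortest_word[OF assms(3,4) k] .
    have "g \<otimes>\<^bsub>G\<^esub> ?k = h" using g h by (simp flip: m_assoc)
    then have "d (\<phi> g x\<^sub>0) (\<phi> h x\<^sub>0) = d (\<phi> g x\<^sub>0) (\<phi> g (\<phi> ?k x\<^sub>0))"
      using composition_rule[OF \<open>x\<^sub>0 \<in> X\<close> g k] by simp
    also have "\<dots> = d x\<^sub>0 (\<phi> ?k x\<^sub>0)" using iso g k inX \<open>x\<^sub>0 \<in> X\<close> by simp
    finally show ?thesis using words[OF ws(2)] ws by (simp add: word_dist_def)
  qed
  moreover have "L > 0" unfolding L_def by (rule add_pos_nonneg) (auto intro: sum_nonneg)
  ultimately show ?thesis by blast
qed

text \<open>Left translation by \<open>a\<close> preserves the word metric, so the colours can be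
  pulled back along it with the same \<open>B\<close>.\<close>

lemma multicover_left_translate:
  assumes "group G" "A \<subseteq> carrier G" "a \<in> carrier G"
    and "multicover (word_dist G S) r B n N A Z"
  shows "multicover (word_dist G S) r B n N {g \<in> carrier G. a \<otimes>\<^bsub>G\<^esub> g \<in> A}
    (\<lambda>i. {g \<in> carrier G. a \<otimes>\<^bsub>G\<^esub> g \<in> Z i})"
proof -
  interpret group G by fact
  have "bounded_components (word_dist G S) r B {g \<in> carrier G. a \<otimes>\<^bsub>G\<^esub> g \<in> Z i}" if "i < N" for i
  proof (rule bounded_components_isometry[where h = "\<lambda>g. a \<otimes>\<^bsub>G\<^esub> g"])
    show "bounded_components (word_dist G S) r B (Z i)"
      using assms(4) that unfolding multicover_def by blast
  qed (use assms(3) word_dist_left_invariant in auto)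
  moreover have "{i. i < N \<and> g \<in> {g \<in> carrier G. a \<otimes>\<^bsub>G\<^esub> g \<in> Z i}} = {i. i < N \<and> a \<otimes>\<^bsub>G\<^esub> g \<in> Z i}"
    if "g \<in> carrier G" for g using that by auto
  ultimately show ?thesis using assms(4) unfolding multicover_def by auto
qed

theorem theorem2:
  fixes G :: "('g, 'm) monoid_scheme"
    and S :: "'g set"
    and X :: "'x set"
    and d :: "'x \<Rightarrow> 'x \<Rightarrow> real"
    and \<phi> :: "'g \<Rightarrow> 'x \<Rightarrow> 'x"
    and x\<^sub>0 :: 'x
    and n k :: nat
  assumes "group G"
    and "finite S" and "S \<subseteq> carrier G" and "generate G S = carrier G"
    and "Metric_space X d"
    and "isometric_action G X d \<phi>"
    and "x\<^sub>0 \<in> X"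
    and "asdim X d \<le> enat k"
    and "\<And>R. R > 0 \<Longrightarrow> asdim (almost_stabilizer G d \<phi> R x\<^sub>0) (word_dist G S) \<le> enat n"
  shows "asdim (carrier G) (word_dist G S) \<le> enat (n + k)"
proof -
  interpret group G by fact
  interpret X: Metric_space X d by fact
  interpret group_action G X \<phi> using assms unfolding isometric_action_def by simp
  have iso: "d (\<phi> g x) (\<phi> g y) = d x y" if "g \<in> carrier G" "x \<in> X" "y \<in> X" for g x y
    using assms that unfolding isometric_action_def by simp
  have inX: "\<phi> g x\<^sub>0 \<in> X" if "g \<in> carrier G" for g using element_image that \<open>x\<^sub>0 \<in> X\<close> by blast
  obtain L where L: "L > 0"
    "\<And>g h. g \<in> carrier G \<Longrightarrow> h \<in> carrier G \<Longrightarrow> d (\<phi> g x\<^sub>0) (\<phi> h x\<^sub>0) \<le> L * word_dist G S g h"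
    using isometric_action_Lipschitz[OF assms(1-7)] by blast
  have "asdim_at_most (carrier G) (word_dist G S) (n + k)"
  proof (rule asdim_at_most_fibration[where f = "\<lambda>g. \<phi> g x\<^sub>0"])
    show "pseudometric_on (carrier G) (word_dist G S)"
      by unfold_locales
        (use word_dist_eq_0_iff word_dist_commute word_dist_triangle assms(3,4) in auto)
    show "pseudometric_on X d"
      by unfold_locales (auto simp: X.commute X.triangle)
    show "asdim_at_most X d k" using assms(8) by (simp add: asdim_le_iff)
    fix R r :: real assume "R > 0" "r > 0"
    let ?W = "almost_stabilizer G d \<phi> R x\<^sub>0"
    have "asdim_at_most ?W (word_dist G S) n" using assms(9)[OF \<open>R > 0\<close>] by (simp add: asdim_le_iff)
    \<comment> \<open>This single \<open>B\<close> serves every orbit point, because the covers used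
      there are translates of \<open>Z\<close>.\<close>
    then obtain B Z where Z: "multicover (word_dist G S) r B n (Suc n) ?W Z"
      using asdim_at_most_multicover \<open>r > 0\<close> by blast
    have W: "?W \<subseteq> carrier G" by (auto simp: almost_stabilizer_def)
    have "\<exists>Z. multicover (word_dist G S) r B n (Suc n) {g \<in> carrier G. d (\<phi> g x\<^sub>0) (\<phi> a x\<^sub>0) \<le> R} Z"
      if a: "a \<in> carrier G" for a
    proof -
      \<comment> \<open>The preimage of the \<open>R\<close>-ball about the orbit point of
        \<open>a\<close> is the left translate of \<open>?W\<close> by \<open>a\<close>, since the
        inverse of \<open>a\<close> acts isometrically and moves that orbit point to
        \<open>x\<^sub>0\<close>.\<close>
      have "inv\<^bsub>G\<^esub> a \<otimes>\<^bsub>G\<^esub> g \<in> ?W \<longleftrightarrow> d (\<phi> g x\<^sub>0) (\<phi> a x\<^sub>0) \<le> R" if g: "g \<in> carrier G" for g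
      proof -
        have "\<phi> g x\<^sub>0 = \<phi> a (\<phi> (inv\<^bsub>G\<^esub> a \<otimes>\<^bsub>G\<^esub> g) x\<^sub>0)"
          using composition_rule[OF \<open>x\<^sub>0 \<in> X\<close> a, of "inv\<^bsub>G\<^esub> a \<otimes>\<^bsub>G\<^esub> g"] a g by (simp flip: m_assoc)
        then show ?thesis
          using iso[OF a inX \<open>x\<^sub>0 \<in> X\<close>, of "inv\<^bsub>G\<^esub> a \<otimes>\<^bsub>G\<^esub> g"] a g by (simp add: almost_stabilizer_def)
      qed
      then have "{g \<in> carrier G. inv\<^bsub>G\<^esub> a \<otimes>\<^bsub>G\<^esub> g \<in> ?W} = {g \<in> carrier G. d (\<phi> g x\<^sub>0) (\<phi> a x\<^sub>0) \<le> R}" by auto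
      then show ?thesis
        using multicover_left_translate[OF \<open>group G\<close> W inv_closed[OF a] Z] by auto
    qed
    then show "\<exists>B. \<forall>a\<in>carrier G. \<exists>Z. multicover (word_dist G S) r B n (Suc n)
        {g \<in> carrier G. d (\<phi> g x\<^sub>0) (\<phi> a x\<^sub>0) \<le> R} Z" by blast
  qed (use L inX in auto)
  then show ?thesis by (simp add: asdim_le_iff)
qed

end
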